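(* Let $\mathcal{A}$ be a (randomized) algorithm that solves the global broadcast problem in $f(n,\mathcal{C},D)$ rounds, in expectation, in the radio network model with collision detection, $\mathcal{C}\ge 1$ channels, and a network topology with diameter $D$ (that is, for every connected $n$-node network of diameter $D$, every choice of source and $\mathcal{C}$ channels, the expected number of rounds until the problem is solved is at most $f(n,\mathcal{C},D)$). Then for every $\mathcal{C},D\ge 1$, $f(n,\mathcal{C},D)\in\Omega(D\log(n/D))$.
   Context: Multichannel radio network model with collision detection: the network is a connected undirected graph $G=(V,E)$ of diameter $D$ with $n=|V|$ nodes having unique ids from $[n]=\{1,\dots,n\}$, and there are $\mathcal{C}\ge1$ orthogonal channels. Executions proceed in synchronous rounds. In each round each node chooses a single channel and either transmits a message or receives on it. A node $u$ receives a message from $v$ on channel $c$ in a round if and only if $u$ receives on $c$, $v$ transmits on $c$, $v$ is a neighbor of $u$ in $G$, and no other neighbor of $u$ transmits on $c$ in that round. Collision detection: a node receiving on a channel can distinguish between silence (no neighbor transmits on it) and collision (two or more neighbors transmit on it). Global broadcast problem: at the beginning of the execution a single source node is provided a message $m$. The problem is solved once every node in the network has received $m$. Nodes have no advance knowledge of the network topology. Nodes are inactive until they first receive $m$: inactive nodes can only listen, all on the same known default channel (channel $1$), and detecting a collision does not activate them. Active nodes execute an arbitrary randomized algorithm. Asymptotics are in $n\to\infty$, with $\mathcal{C}$ and $D$ quantified first as in the claim.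
   Formalization: The claim is proved for D ≥ 2 instead of D ≥ 1: at D = 1 the network is complete, so a source transmitting alone on channel 1 in round 1 informs every node, allowing f(n,C,1) = 1, which is not Ω(log n). *)

theory Defs
  imports "HOL-Probability.Probability" "HOL-Library.Landau_Symbols"
begin

section \<open>Networks\<close>

text \<open>
  Nodes are identified with their ids, so the vertex set of an \<open>n\<close>-node network is
  \<open>{1..n}\<close>. The edge set of the undirected graph is a symmetric, irreflexive relation.
\<close>

definition connected_network :: "nat \<Rightarrow> nat rel \<Rightarrow> bool" where
  "connected_network n E \<longleftrightarrow>
     1 \<le> n \<and> E \<subseteq> {1..n} \<times> {1..n} \<and> sym E \<and> irrefl E \<and>
     (\<forall>u\<in>{1..n}. \<forall>v\<in>{1..n}. (u, v) \<in> E\<^sup>*)"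

definition hop_dist :: "nat rel \<Rightarrow> nat \<Rightarrow> nat \<Rightarrow> nat" where
  "hop_dist E u v = (LEAST k. (u, v) \<in> E ^^ k)"

definition diameter_network :: "nat \<Rightarrow> nat rel \<Rightarrow> nat" where
  "diameter_network n E = Max {hop_dist E u v |u v. u \<in> {1..n} \<and> v \<in> {1..n}}"


section \<open>Multichannel radio model with collision detection\<close>

text \<open>
  A packet is a flag telling whether it contains the broadcast message \<open>m\<close>, together with
  arbitrary further content. Only active nodes transmit, and every active node holds \<open>m\<close>,
  so any packet may legitimately carry the flag.
\<close>

type_synonym 'a packet = "bool \<times> 'a"

abbreviation carries_m :: "'a packet \<Rightarrow> bool" where
  "carries_m p \<equiv> fst p"

datatype 'a action = Transmit (chan: nat) "'a packet" | Listen (chan: nat)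

text \<open>
  What a node learns in one round; \<open>Own_Transmission\<close> is the (empty) feedback of a
  transmitting node.
\<close>

datatype 'a feedback = Silence | Collision | Received "'a packet" | Own_Transmission

definition transmitters :: "nat rel \<Rightarrow> (nat \<Rightarrow> 'a action) \<Rightarrow> nat \<Rightarrow> nat \<Rightarrow> nat set" where
  "transmitters E act u c = {v. (u, v) \<in> E \<and> (\<exists>p. act v = Transmit c p)}"

definition feedback_of :: "nat rel \<Rightarrow> (nat \<Rightarrow> 'a action) \<Rightarrow> nat \<Rightarrow> 'a feedback" where
  "feedback_of E act u =
     (case act u of
        Transmit c p \<Rightarrow> Own_Transmission
      | Listen c \<Rightarrow>
          (if transmitters E act u c = {} then Silence
           else if \<exists>v. transmitters E act u c = {v}
             then Received (THE p. \<exists>v. transmitters E act u c = {v} \<and> act v = Transmit c p)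
           else Collision))"


section \<open>Randomized algorithms and their executions\<close>

text \<open>
  \<open>A n C u b x h\<close> is the action that the node with id \<open>u\<close> takes if it is active,
  where \<open>n\<close> is the network size, \<open>C\<close> the number of channels, \<open>b\<close> tells whether the node
  is the source, \<open>x\<close> is the outcome of its private randomness, and \<open>h\<close> is its feedback in
  all earlier rounds (so the length of \<open>h\<close> is the number of rounds elapsed). Own earlier
  actions are determined by these data. The graph, its diameter and the other nodes'
  randomness are not available to the node.
\<close>

type_synonym ('r, 'a) algorithm =
  "nat \<Rightarrow> nat \<Rightarrow> nat \<Rightarrow> bool \<Rightarrow> 'r \<Rightarrow> 'a feedback list \<Rightarrow> 'a action"

text \<open>
  Every node draws one sample from the probability space \<open>R\<close> before the execution starts,
  independently of the others; since \<open>R\<close> is arbitrary, the sample may encode an infinite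
  sequence of coin flips, consulted round by round.
\<close>

definition randomized_algorithm :: "'r measure \<Rightarrow> ('r, 'a::countable) algorithm \<Rightarrow> bool" where
  "randomized_algorithm R A \<longleftrightarrow>
     prob_space R \<and>
     (\<forall>n C u b h. (\<lambda>x. A n C u b x h) \<in> measurable R (count_space UNIV)) \<and>
     (\<forall>n C u b x h. 1 \<le> C \<longrightarrow> chan (A n C u b x h) \<in> {1..C})"

text \<open>\<open>s\<close> is the source throughout; active nodes are exactly those that have received \<open>m\<close>.\<close>

definition active :: "nat \<Rightarrow> nat \<Rightarrow> 'a feedback list \<Rightarrow> bool" where
  "active s u h \<longleftrightarrow> u = s \<or> (\<exists>p. Received p \<in> set h \<and> carries_m p)"

definition node_action ::
  "('r, 'a) algorithm \<Rightarrow> nat \<Rightarrow> nat \<Rightarrow> nat \<Rightarrow> (nat \<Rightarrow> 'r) \<Rightarrow> nat \<Rightarrow> 'a feedback list \<Rightarrow> 'a action" where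
  "node_action A n C s \<omega> u h =
     (if active s u h then A n C u (u = s) (\<omega> u) h else Listen 1)"

primrec history ::
  "('r, 'a) algorithm \<Rightarrow> nat \<Rightarrow> nat \<Rightarrow> nat rel \<Rightarrow> nat \<Rightarrow> (nat \<Rightarrow> 'r) \<Rightarrow> nat \<Rightarrow> (nat \<Rightarrow> 'a feedback list)"
where
  "history A n C E s \<omega> 0 = (\<lambda>u. [])"
| "history A n C E s \<omega> (Suc r) =
     (\<lambda>u. history A n C E s \<omega> r u @
        [feedback_of E (\<lambda>v. node_action A n C s \<omega> v (history A n C E s \<omega> r v)) u])"

definition broadcast_solved ::
  "('r, 'a) algorithm \<Rightarrow> nat \<Rightarrow> nat \<Rightarrow> nat rel \<Rightarrow> nat \<Rightarrow> (nat \<Rightarrow> 'r) \<Rightarrow> nat \<Rightarrow> bool" where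
  "broadcast_solved A n C E s \<omega> r \<longleftrightarrow>
     (\<forall>u\<in>{1..n}. active s u (history A n C E s \<omega> r u))"

text \<open>The number of rounds is infinite if the problem is never solved.\<close>

definition broadcast_rounds ::
  "('r, 'a) algorithm \<Rightarrow> nat \<Rightarrow> nat \<Rightarrow> nat rel \<Rightarrow> nat \<Rightarrow> (nat \<Rightarrow> 'r) \<Rightarrow> ennreal" where
  "broadcast_rounds A n C E s \<omega> =
     (INF r\<in>{r. broadcast_solved A n C E s \<omega> r}. of_nat r)"

definition expected_rounds ::
  "'r measure \<Rightarrow> ('r, 'a) algorithm \<Rightarrow> nat \<Rightarrow> nat \<Rightarrow> nat rel \<Rightarrow> nat \<Rightarrow> ennreal" where
  "expected_rounds R A n C E s =
     (\<integral>\<^sup>+ \<omega>. broadcast_rounds A n C E s \<omega> \<partial>(PiM {1..n} (\<lambda>_. R)))"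

definition solves_global_broadcast ::
  "'r measure \<Rightarrow> ('r, 'a::countable) algorithm \<Rightarrow> (nat \<Rightarrow> nat \<Rightarrow> nat \<Rightarrow> real) \<Rightarrow> bool" where
  "solves_global_broadcast R A f \<longleftrightarrow>
     randomized_algorithm R A \<and>
     (\<forall>n C D E s. 1 \<le> C \<longrightarrow> connected_network n E \<longrightarrow> diameter_network n E = D \<longrightarrow>
        s \<in> {1..n} \<longrightarrow> expected_rounds R A n C E s \<le> ennreal (f n C D))"

text \<open>
  Lower bounds in terms of \<open>f\<close> need care at \<open>D = 1\<close>: on a complete graph a single transmission
  of the source on channel 1 informs every node, so \<open>f n C 1 = 1\<close> is attainable.
\<close>

end

theory Submission
  imports Defs "HOL-Real_Asymp.Real_Asymp"
begin

text \<open>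
  Since \<open>D\<close> is fixed, it suffices to show \<open>f n C D \<ge> c * log 2 n\<close>. Take a clique containing the source,
  attach a node \<open>t\<close> to an unknown nonempty set \<open>S\<close> of clique nodes, and attach to \<open>t\<close> a path that
  brings the diameter up to \<open>D\<close>. Until \<open>t\<close> is informed, neither \<open>t\<close> nor the path transmits, so the
  clique behaves as if it were alone; \<open>t\<close> is informed only in a round in which exactly one node
  of \<open>S\<close> transmits on channel 1. Hence the clique has to produce transmitter sets \<open>T\<close> with
  \<open>card (T \<inter> S) = 1\<close> without any information on \<open>S\<close>. Choose a scale \<open>k \<in> {1..L}\<close> uniformly and put every
  node into \<open>S\<close> with probability \<open>1 / 2 ^ k\<close>: a fixed \<open>T\<close> then succeeds with probability at most
  \<open>2 / L\<close>, so by averaging some \<open>S\<close> survives \<open>L div 8\<close> rounds with probability at least \<open>1 / 2\<close>.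
  The set \<open>S\<close> is rarely empty as long as \<open>2 ^ L\<close> is at most a third of the clique size.
\<close>

section \<open>The hard networks\<close>

definition clique :: "nat \<Rightarrow> nat rel" where
  "clique m = {(u, v). u \<noteq> v \<and> u \<in> {1..m} \<and> v \<in> {1..m}}"

text \<open>Node \<open>m + 1\<close> is the \<open>t\<close> of the overview and begins a path
  ending at \<open>m + D - 1\<close>. When the source 1 lies outside \<open>S\<close>, it is two
  hops away from \<open>m + 1\<close> and the path adds \<open>D - 2\<close> more, hence the
  diameter \<open>D\<close>.\<close>

definition hard_network :: "nat \<Rightarrow> nat \<Rightarrow> nat set \<Rightarrow> nat rel" where
  "hard_network m D S = clique m \<union> S \<times> {m + 1} \<union> {m + 1} \<times> S \<union>
     {(u, v). m < u \<and> m < v \<and> u < m + D \<and> v < m + D \<and> (v = u + 1 \<or> u = v + 1)}"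

lemma sym_hard_network: "sym (hard_network m D S)"
  by (auto simp: sym_def hard_network_def clique_def)

lemma relpow_sym:
  assumes "sym E" "(u, v) \<in> E ^^ k"
  shows "(v, u) \<in> E ^^ k"
  using assms(2)
proof (induction k arbitrary: v)
  case (Suc k)
  then obtain w where "(u, w) \<in> E ^^ k" "(w, v) \<in> E" by auto
  then show ?case using Suc.IH assms(1) by (metis relpow_Suc_I2 symE)
qed auto

lemma hard_network_tail_path:
  assumes "m < u" "u + k < m + D"
  shows "(u, u + k) \<in> hard_network m D S ^^ k"
  using assms(2)
proof (induction k)
  case (Suc k)
  have "(u + k, u + Suc k) \<in> hard_network m D S"
    using Suc.prems assms(1) by (auto simp: hard_network_def)
  then show ?case using Suc by auto
qed auto

text \<open>The extreme case is a clique node outside \<open>S\<close>: one hop into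
  \<open>S\<close>, one to \<open>m + 1\<close>, and at most \<open>D - 2\<close> along the
  path.\<close>

lemma hard_network_path_aux:
  assumes S: "S \<subseteq> {2..m}" "S \<noteq> {}" and D: "2 \<le> D"
    and uv: "u \<in> {1..m + D - 1}" "v \<in> {1..m + D - 1}" "u \<le> v"
  shows "\<exists>k\<le>D. (u, v) \<in> hard_network m D S ^^ k"
proof -
  let ?E = "hard_network m D S"
  obtain x where x: "x \<in> S" using S by auto
  have xm: "x \<le> m" "1 \<le> x" using x S by auto
  consider "v \<le> m" | "m < u" | "u \<le> m" "m < v" by linarith
  then show ?thesis
  proof cases
    case 1
    show ?thesis
    proof (cases "u = v")
      case True
      then show ?thesis by (intro exI[of _ 0]) auto
    next
      case False
      then have "(u, v) \<in> ?E" using 1 uv by (auto simp: hard_network_def clique_def)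
      then show ?thesis using D by (intro exI[of _ 1]) auto
    qed
  next
    case 2
    then have "(u, u + (v - u)) \<in> ?E ^^ (v - u)"
      using uv by (intro hard_network_tail_path) auto
    then show ?thesis using 2 uv by (intro exI[of _ "v - u"]) auto
  next
    case 3
    define k where "k = v - (m + 1)"
    have "(m + 1, m + 1 + k) \<in> ?E ^^ k"
      using 3 uv unfolding k_def by (intro hard_network_tail_path) auto
    then have tail: "(m + 1, v) \<in> ?E ^^ k" using 3 by (simp add: k_def)
    have kD: "k + 2 \<le> D" using 3 uv by (auto simp: k_def)
    have S_tail: "(y, v) \<in> ?E ^^ Suc k" if "y \<in> S" for y
    proof -
      have "(y, m + 1) \<in> ?E" using that by (auto simp: hard_network_def)
      then show ?thesis using tail by (rule relpow_Suc_I2)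
    qed
    show ?thesis
    proof (cases "u \<in> S")
      case True
      then show ?thesis using S_tail kD by (intro exI[of _ "Suc k"]) auto
    next
      case False
      then have "(u, x) \<in> ?E" using 3 uv x xm by (auto simp: hard_network_def clique_def)
      then have "(u, v) \<in> ?E ^^ Suc (Suc k)" using S_tail[OF x] by (rule relpow_Suc_I2)
      then show ?thesis using kD by (intro exI[of _ "Suc (Suc k)"]) auto
    qed
  qed
qed

lemma hard_network_path:
  assumes "S \<subseteq> {2..m}" "S \<noteq> {}" "2 \<le> D"
    and "u \<in> {1..m + D - 1}" "v \<in> {1..m + D - 1}"
  shows "\<exists>k\<le>D. (u, v) \<in> hard_network m D S ^^ k"
proof (cases "u \<le> v")
  case True
  then show ?thesis using assms hard_network_path_aux by blast
next
  case False
  then obtain k where "k \<le> D" "(v, u) \<in> hard_network m D S ^^ k"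
    using assms hard_network_path_aux[of S m D v u] by auto
  then show ?thesis using relpow_sym[OF sym_hard_network] by blast
qed

lemma hard_network_subset:
  assumes "S \<subseteq> {2..m}" "2 \<le> D"
  shows "hard_network m D S \<subseteq> {1..m + D - 1} \<times> {1..m + D - 1}"
  using assms by (fastforce simp: hard_network_def clique_def)

lemma connected_hard_network:
  assumes "S \<subseteq> {2..m}" "S \<noteq> {}" "2 \<le> D"
  shows "connected_network (m + D - 1) (hard_network m D S)"
proof -
  have "irrefl (hard_network m D S)"
    using assms by (auto simp: irrefl_def hard_network_def clique_def)
  moreover have "(u, v) \<in> (hard_network m D S)\<^sup>*"
    if "u \<in> {1..m + D - 1}" "v \<in> {1..m + D - 1}" for u v
    using hard_network_path[OF assms that] relpow_imp_rtrancl by blast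
  ultimately show ?thesis
    using hard_network_subset assms sym_hard_network unfolding connected_network_def by auto
qed

text \<open>Serves to bound distances from below: a walk is at least as long as the rise of the
  potential between its ends.\<close>

lemma relpow_potential:
  assumes "\<And>u v. (u, v) \<in> E \<Longrightarrow> \<phi> v \<le> \<phi> u + (1 :: nat)"
  shows "(u, v) \<in> E ^^ k \<Longrightarrow> \<phi> v \<le> \<phi> u + k"
proof (induction k arbitrary: v)
  case (Suc k)
  then obtain w where "(u, w) \<in> E ^^ k" "(w, v) \<in> E" by auto
  then show ?case using Suc.IH[of w] assms[of w v] by simp
qed auto

lemma diameter_hard_network:
  assumes S: "S \<subseteq> {2..m}" "S \<noteq> {}" and D: "2 \<le> D"
  shows "diameter_network (m + D - 1) (hard_network m D S) = D"
proof -
  let ?E = "hard_network m D S" and ?V = "{1..m + D - 1}"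
  have le: "hop_dist ?E u v \<le> D" if uv: "u \<in> ?V" "v \<in> ?V" for u v
  proof -
    obtain k where "k \<le> D" "(u, v) \<in> ?E ^^ k" using hard_network_path[OF S D uv] by blast
    then show ?thesis unfolding hop_dist_def by (meson Least_le order_trans)
  qed
  \<comment> \<open>On the nodes of the network, \<open>\<phi>\<close> is the distance from the set
    of clique nodes outside \<open>S\<close>, which contains node 1.\<close>
  define \<phi> where "\<phi> u = (if m < u then u - m + 1 else if u \<in> S then 1 else 0)" for u
  have m: "1 \<in> ?V" "m + D - 1 \<in> ?V" using S D by auto
  have "\<phi> v \<le> \<phi> u + 1" if "(u, v) \<in> ?E" for u v
    using that S unfolding \<phi>_def hard_network_def clique_def by auto
  then have "\<phi> (m + D - 1) \<le> \<phi> 1 + k" if "(1, m + D - 1) \<in> ?E ^^ k" for k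
    using that by (rule relpow_potential)
  moreover have "(1, m + D - 1) \<in> ?E ^^ hop_dist ?E 1 (m + D - 1)"
    unfolding hop_dist_def using hard_network_path[OF S D m] by (meson LeastI)
  ultimately have "\<phi> (m + D - 1) \<le> \<phi> 1 + hop_dist ?E 1 (m + D - 1)" by blast
  moreover have "\<phi> 1 = 0" "\<phi> (m + D - 1) = D"
    using S D by (auto simp: \<phi>_def)
  ultimately have eq: "hop_dist ?E 1 (m + D - 1) = D" using le[OF m] by simp
  show ?thesis unfolding diameter_network_def
  proof (rule Max_eqI)
    show "finite {hop_dist ?E u v |u v. u \<in> ?V \<and> v \<in> ?V}"
      by (rule finite_subset[of _ "{..D}"]) (use le in auto)
    show "D \<in> {hop_dist ?E u v |u v. u \<in> ?V \<and> v \<in> ?V}" using eq m by force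
  qed (use le in auto)
qed

section \<open>Simulation of the isolated clique\<close>

lemma active_snoc:
  "active s u (h @ [x]) \<longleftrightarrow> active s u h \<or> (\<exists>p. x = Received p \<and> carries_m p)"
  by (auto simp: active_def)

text \<open>The edge sets may differ, so that feedback in the hard network can be compared with
  feedback in the clique. A unique transmitter lies in both equal transmitter sets, hence is a
  common neighbour, where the actions agree.\<close>

lemma feedback_of_cong:
  assumes "act u = act' u"
    and "\<And>c. transmitters E act u c = transmitters E' act' u c"
    and "\<And>v. (u, v) \<in> E \<inter> E' \<Longrightarrow> act v = act' v"
  shows "feedback_of E act u = feedback_of E' act' u"
proof -
  have "(THE p. \<exists>v. transmitters E act u c = {v} \<and> act v = Transmit c p) =
        (THE p. \<exists>v. transmitters E' act' u c = {v} \<and> act' v = Transmit c p)" for c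
  proof -
    have "act v = act' v" if "transmitters E' act' u c = {v}" for v
    proof -
      have "(u, v) \<in> E" using assms(2)[of c] that by (auto simp: transmitters_def)
      moreover have "(u, v) \<in> E'" using that by (auto simp: transmitters_def)
      ultimately show ?thesis using assms(3) by blast
    qed
    then show ?thesis using assms(2) by metis
  qed
  then show ?thesis unfolding feedback_of_def assms(1) assms(2) by (simp split: action.split)
qed

text \<open>The clique runs alone, yet its nodes are told the size \<open>n\<close> of the whole
  network. Nothing here refers to \<open>S\<close>, so the transmitter sets are determined before
  \<open>S\<close> is chosen.\<close>

definition clique_action ::
  "('r, 'a) algorithm \<Rightarrow> nat \<Rightarrow> nat \<Rightarrow> nat \<Rightarrow> (nat \<Rightarrow> 'r) \<Rightarrow> nat \<Rightarrow> nat \<Rightarrow> 'a action" where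
  "clique_action A n C m \<omega> r u = node_action A n C 1 \<omega> u (history A n C (clique m) 1 \<omega> r u)"

definition clique_transmitters ::
  "('r, 'a) algorithm \<Rightarrow> nat \<Rightarrow> nat \<Rightarrow> nat \<Rightarrow> (nat \<Rightarrow> 'r) \<Rightarrow> nat \<Rightarrow> nat set" where
  "clique_transmitters A n C m \<omega> r =
     {u \<in> {1..m}. \<exists>p. clique_action A n C m \<omega> r u = Transmit 1 p}"

text \<open>Inactive path nodes only listen, so clique nodes, including those in \<open>S\<close>,
  hear exactly what they hear in the clique. Node \<open>m + 1\<close> gets silence or a collision
  in every round with a miss, and neither activates it.\<close>

lemma hard_network_simulates_clique:
  assumes S: "S \<subseteq> {2..m}" "S \<noteq> {}"
    and miss: "\<And>j. j < r \<Longrightarrow> card (clique_transmitters A n C m \<omega> j \<inter> S) \<noteq> 1"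
  shows "(\<forall>u\<in>{1..m}. history A n C (hard_network m D S) 1 \<omega> r u = history A n C (clique m) 1 \<omega> r u)
       \<and> (\<forall>u>m. \<not> active 1 u (history A n C (hard_network m D S) 1 \<omega> r u))"
  using miss
proof (induction r)
  case 0
  then show ?case using S by (auto simp: active_def)
next
  case (Suc r)
  let ?E = "hard_network m D S"
  let ?H = "history A n C ?E 1 \<omega> r"
  define act where "act v = node_action A n C 1 \<omega> v (?H v)" for v
  define act0 where "act0 v = clique_action A n C m \<omega> r v" for v
  have IH: "\<And>u. u \<in> {1..m} \<Longrightarrow> ?H u = history A n C (clique m) 1 \<omega> r u"
      "\<And>u. u > m \<Longrightarrow> \<not> active 1 u (?H u)"
    using Suc by auto
  have act_K: "act u = act0 u" if "u \<in> {1..m}" for u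
    using IH(1)[OF that] by (simp add: act_def act0_def clique_action_def)
  have act_T: "act u = Listen 1" if "u > m" for u
    using IH(2)[OF that] by (simp add: act_def node_action_def)
  have fb_K: "feedback_of ?E act u = feedback_of (clique m) act0 u" if u: "u \<in> {1..m}" for u
  proof (rule feedback_of_cong)
    show "transmitters ?E act u c = transmitters (clique m) act0 u c" for c
    proof -
      have "(u, v) \<in> ?E \<and> (\<exists>p. act v = Transmit c p) \<longleftrightarrow>
            (u, v) \<in> clique m \<and> (\<exists>p. act0 v = Transmit c p)" for v
      proof (cases "m < v")
        case True
        then show ?thesis using act_T[of v] by (auto simp: clique_def)
      next
        case False
        then have "(u, v) \<in> ?E \<longleftrightarrow> (u, v) \<in> clique m"
          using u S by (auto simp: hard_network_def)
        moreover have "act v = act0 v" if "(u, v) \<in> clique m"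
          using act_K[of v] that by (simp add: clique_def)
        ultimately show ?thesis by metis
      qed
      then show ?thesis by (auto simp: transmitters_def)
    qed
  qed (use u act_K in \<open>auto simp: clique_def\<close>)
  have fb_T: "feedback_of ?E act u \<noteq> Received p" if u: "u > m" for u p
  proof -
    \<comment> \<open>Channel 1 is the only one that inactive nodes listen on. A path node beyond
      \<open>m + 1\<close> has only silent path neighbours.\<close>
    have *: "(u, v) \<in> ?E \<and> (\<exists>p. act v = Transmit 1 p) \<longleftrightarrow>
            u = m + 1 \<and> v \<in> clique_transmitters A n C m \<omega> r \<inter> S" for v
    proof (cases "m < v")
      case True
      then show ?thesis using act_T[of v] S by auto
    next
      case False
      then have "(u, v) \<in> ?E \<longleftrightarrow> u = m + 1 \<and> v \<in> S"
        using u by (auto simp: hard_network_def clique_def)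
      moreover have "v \<in> {1..m} \<and> act v = act0 v" if "v \<in> S"
        using act_K[of v] that S by auto
      ultimately show ?thesis
        unfolding clique_transmitters_def act0_def by (cases "v \<in> S") simp_all
    qed
    have "transmitters ?E act u 1 = (if u = m + 1 then clique_transmitters A n C m \<omega> r \<inter> S else {})"
      unfolding transmitters_def * by auto
    then have "card (transmitters ?E act u 1) \<noteq> 1" using Suc.prems[of r] by auto
    then show ?thesis using act_T[OF u] by (auto simp: feedback_of_def)
  qed
  have "history A n C ?E 1 \<omega> (Suc r) u = ?H u @ [feedback_of ?E act u]"
    and "history A n C (clique m) 1 \<omega> (Suc r) u =
       history A n C (clique m) 1 \<omega> r u @ [feedback_of (clique m) act0 u]" for u
    by (simp_all add: act_def[abs_def] act0_def[abs_def] clique_action_def[abs_def])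
  then show ?case using IH fb_K fb_T by (simp add: active_snoc del: history.simps)
qed

text \<open>After \<open>r\<close> misses node \<open>m + 1\<close> is still uninformed, so round
  count \<open>r\<close> itself is excluded, which gives \<open>Suc r\<close>. An execution that
  never succeeds is covered by the infimum of the empty set.\<close>

lemma broadcast_rounds_ge:
  assumes S: "S \<subseteq> {2..m}" "S \<noteq> {}" and D: "2 \<le> D"
    and miss: "\<And>j. j < r \<Longrightarrow> card (clique_transmitters A n C m \<omega> j \<inter> S) \<noteq> 1"
    and n: "n = m + D - 1"
  shows "of_nat (Suc r) \<le> broadcast_rounds A n C (hard_network m D S) 1 \<omega>"
proof -
  have "Suc r \<le> r'" if solved: "broadcast_solved A n C (hard_network m D S) 1 \<omega> r'" for r'
  proof (rule ccontr)
    assume "\<not> Suc r \<le> r'"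
    then have "\<And>j. j < r' \<Longrightarrow> card (clique_transmitters A n C m \<omega> j \<inter> S) \<noteq> 1"
      using miss by simp
    from hard_network_simulates_clique[where D = D, OF S this]
    have "\<not> active 1 (m + 1) (history A n C (hard_network m D S) 1 \<omega> r' (m + 1))" by simp
    moreover have "m + 1 \<in> {1..n}" using D n by auto
    ultimately show False using solved by (auto simp: broadcast_solved_def)
  qed
  then show ?thesis unfolding broadcast_rounds_def by (intro INF_greatest) (simp add: of_nat_le_iff del: of_nat_Suc)
qed

section \<open>Measurability of the execution on the clique\<close>

instance feedback :: (countable) countable
  by countable_datatype

instance action :: (countable) countable
  by countable_datatype

text \<open>Coordinates are frozen one at a time: with coordinate \<open>i\<close> set to a constant
  \<open>c\<close> the induction hypothesis applies, and there are only countably many values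
  \<open>c\<close> to glue together.\<close>

lemma measurable_finite_dependence:
  fixes g :: "'i \<Rightarrow> 'w \<Rightarrow> 'b::countable"
  assumes "finite I"
    and "\<And>i. i \<in> I \<Longrightarrow> g i \<in> measurable M (count_space UNIV)"
    and "\<And>a b. (\<And>i. i \<in> I \<Longrightarrow> a i = b i) \<Longrightarrow> \<Phi> a = \<Phi> b"
  shows "(\<lambda>\<omega>. \<Phi> (\<lambda>i. g i \<omega>)) \<in> measurable M (count_space UNIV)"
  using assms
proof (induction I arbitrary: \<Phi> rule: finite_induct)
  case empty
  have "\<Phi> a = \<Phi> b" for a b using empty by blast
  then have "(\<lambda>\<omega>. \<Phi> (\<lambda>i. g i \<omega>)) = (\<lambda>\<omega>. \<Phi> undefined)" by blast
  then show ?case by simp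
next
  case (insert i I)
  have "(\<lambda>\<omega>. \<Phi> ((\<lambda>j. g j \<omega>)(i := c))) \<in> measurable M (count_space UNIV)" for c
    by (rule insert.IH[of "\<lambda>a. \<Phi> (a(i := c))"]) (auto intro!: insert.prems)
  then have "(\<lambda>\<omega>. \<Phi> ((\<lambda>j. g j \<omega>)(i := g i \<omega>))) \<in> measurable M (count_space UNIV)"
    by (rule measurable_compose_countable[where f = "\<lambda>c \<omega>. \<Phi> ((\<lambda>j. g j \<omega>)(i := c))"])
       (auto intro: insert.prems)
  moreover have "(\<lambda>j. g j \<omega>)(i := g i \<omega>) = (\<lambda>j. g j \<omega>)" for \<omega> by auto
  ultimately show ?case by simp
qed

lemma measurable_node_action:
  assumes A: "randomized_algorithm R A" and u: "u \<in> {1..n}"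
    and h: "h \<in> measurable (PiM {1..n} (\<lambda>_. R)) (count_space UNIV)"
  shows "(\<lambda>\<omega>. node_action A n C s \<omega> u (h \<omega>)) \<in>
           measurable (PiM {1..n} (\<lambda>_. R)) (count_space UNIV)"
\<comment> \<open>For each of the countably many histories \<open>y\<close>, the action depends only
  on the node's own sample.\<close>
proof (rule measurable_compose_countable[OF _ h])
  fix y
  have "(\<lambda>\<omega>. A n C u (u = s) (\<omega> u) y) \<in> measurable (PiM {1..n} (\<lambda>_. R)) (count_space UNIV)"
  proof (rule measurable_compose[where g = "\<lambda>x. A n C u (u = s) x y"])
    show "(\<lambda>\<omega>. \<omega> u) \<in> measurable (PiM {1..n} (\<lambda>_. R)) R"
      using u by (rule measurable_component_singleton)
  qed (use A in \<open>simp add: randomized_algorithm_def\<close>)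
  then show "(\<lambda>\<omega>. node_action A n C s \<omega> u y) \<in> measurable (PiM {1..n} (\<lambda>_. R)) (count_space UNIV)"
    by (cases "active s u y") (simp_all add: node_action_def)
qed

lemma measurable_clique_history:
  assumes A: "randomized_algorithm R A" and m: "m \<le> n" and u: "u \<in> {1..m}"
  shows "(\<lambda>\<omega>. history A n C (clique m) s \<omega> r u) \<in>
           measurable (PiM {1..n} (\<lambda>_. R)) (count_space UNIV)"
  using u
proof (induction r arbitrary: u)
  case (Suc r)
  let ?M = "PiM {1..n} (\<lambda>_. R)"
  let ?act = "\<lambda>v \<omega>. node_action A n C s \<omega> v (history A n C (clique m) s \<omega> r v)"
  have "?act v \<in> measurable ?M (count_space UNIV)" if "v \<in> {1..m}" for v
    using measurable_node_action[OF A _ Suc.IH[OF that]] that m by simp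
  then have fb: "(\<lambda>\<omega>. feedback_of (clique m) (\<lambda>v. ?act v \<omega>) u) \<in> measurable ?M (count_space UNIV)"
  proof (rule measurable_finite_dependence[rotated])
    fix a b :: "nat \<Rightarrow> 'b action"
    assume ab: "\<And>i. i \<in> {1..m} \<Longrightarrow> a i = b i"
    show "feedback_of (clique m) a u = feedback_of (clique m) b u"
    proof (rule feedback_of_cong)
      show "transmitters (clique m) a u c = transmitters (clique m) b u c" for c
        using ab unfolding transmitters_def clique_def by fastforce
    qed (use ab Suc.prems in \<open>auto simp: clique_def\<close>)
  qed auto
  have "(\<lambda>\<omega>. history A n C (clique m) s \<omega> r u @ [x]) \<in> measurable ?M (count_space UNIV)" for x
    by (rule measurable_compose[OF Suc.IH[OF Suc.prems]]) simp
  from measurable_compose_countable[OF this fb] show ?case by simp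
qed simp

lemma sets_clique_transmitters_miss:
  assumes A: "randomized_algorithm R A" and m: "m \<le> n"
  defines "M \<equiv> PiM {1..n} (\<lambda>_. R)"
  shows "{\<omega> \<in> space M. \<forall>j<r. card (clique_transmitters A n C m \<omega> j \<inter> S) \<noteq> 1} \<in> sets M"
proof -
  have "(\<lambda>\<omega>. card (clique_transmitters A n C m \<omega> j \<inter> S) \<noteq> 1) \<in> measurable M (count_space UNIV)" for j
    unfolding clique_transmitters_def
  proof (rule measurable_finite_dependence[where I = "{1..m}"
        and \<Phi> = "\<lambda>a. card ({u \<in> {1..m}. \<exists>p. a u = Transmit 1 p} \<inter> S) \<noteq> 1"
        and g = "\<lambda>u \<omega>. clique_action A n C m \<omega> j u"])
    show "(\<lambda>\<omega>. clique_action A n C m \<omega> j u) \<in> measurable M (count_space UNIV)"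
      if "u \<in> {1..m}" for u
      unfolding clique_action_def M_def using that m
      by (intro measurable_node_action[OF A] measurable_clique_history[OF A]) auto
    fix a b :: "nat \<Rightarrow> 'b action"
    assume "\<And>i. i \<in> {1..m} \<Longrightarrow> a i = b i"
    then have "{u \<in> {1..m}. \<exists>p. a u = Transmit 1 p} = {u \<in> {1..m}. \<exists>p. b u = Transmit 1 p}"
      by auto
    then show "(card ({u \<in> {1..m}. \<exists>p. a u = Transmit 1 p} \<inter> S) \<noteq> 1) =
               (card ({u \<in> {1..m}. \<exists>p. b u = Transmit 1 p} \<inter> S) \<noteq> 1)" by simp
  qed simp
  then show ?thesis by measurable
qed

section \<open>A random set of neighbours\<close>

definition random_subset :: "'a set \<Rightarrow> real \<Rightarrow> 'a set pmf" where
  "random_subset X p = map_pmf (\<lambda>f. {x \<in> X. f x}) (Pi_pmf X False (\<lambda>_. bernoulli_pmf p))"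

lemma set_pmf_random_subset: "set_pmf (random_subset X p) \<subseteq> Pow X"
  by (auto simp: random_subset_def)

text \<open>\<open>T\<close> may reach outside \<open>X\<close>: it will be a transmitter set, which
  can contain the source, while \<open>S\<close> is drawn from \<open>{2..m}\<close>.\<close>

lemma map_pmf_card_random_subset:
  assumes X: "finite X" and p: "p \<in> {0..1}"
  shows "map_pmf (\<lambda>S. card (T \<inter> S)) (random_subset X p) = binomial_pmf (card (T \<inter> X)) p"
proof -
  have "binomial_pmf (card (T \<inter> X)) p =
      map_pmf (\<lambda>f. card {x \<in> T \<inter> X. f x}) (Pi_pmf (T \<inter> X) False (\<lambda>_. bernoulli_pmf p))"
    using X p by (intro binomial_pmf_altdef') auto
  also have "Pi_pmf (T \<inter> X) False (\<lambda>_. bernoulli_pmf p) =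
      map_pmf (\<lambda>f x. if x \<in> T \<inter> X then f x else False) (Pi_pmf X False (\<lambda>_. bernoulli_pmf p))"
    using X by (intro Pi_pmf_subset) auto
  finally show ?thesis
    unfolding random_subset_def map_pmf_comp
    by (auto intro!: map_pmf_cong arg_cong[of _ _ card])
qed

lemma prob_random_subset_card:
  assumes "finite X" "p \<in> {0..1}"
  shows "measure_pmf.prob (random_subset X p) {S. card (T \<inter> S) = k} =
           pmf (binomial_pmf (card (T \<inter> X)) p) k"
  unfolding map_pmf_card_random_subset[OF assms, symmetric] pmf_map
  by (rule arg_cong[of _ _ "measure_pmf.prob _"]) auto

lemma prob_random_subset_empty:
  assumes X: "finite X" and p: "p \<in> {0..1}"
  shows "measure_pmf.prob (random_subset X p) {{}} = (1 - p) ^ card X"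
proof -
  have "measure_pmf.prob (random_subset X p) {{}} =
        measure_pmf.prob (random_subset X p) {S. card (X \<inter> S) = 0}"
  \<comment> \<open>The two events differ only on sets that are not subsets of \<open>X\<close>,
    which have probability 0.\<close>
  proof (rule measure_pmf.finite_measure_eq_AE)
    show "AE S in random_subset X p. S \<in> {{}} \<longleftrightarrow> S \<in> {S. card (X \<inter> S) = 0}"
      using set_pmf_random_subset[of X p] X
      by (auto simp: AE_measure_pmf_iff card_eq_0_iff)
  qed auto
  also have "\<dots> = pmf (binomial_pmf (card X) p) 0"
    using prob_random_subset_card[OF assms, of X 0] by simp
  also have "\<dots> = (1 - p) ^ card X" using p by simp
  finally show ?thesis .
qed

section \<open>Hitting probabilities at a uniformly chosen scale\<close>

text \<open>\<open>x ^ t - y ^ t\<close> is \<open>x - y\<close> times a sum of \<open>t\<close>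
  products of powers of \<open>x\<close> and \<open>y\<close> of total degree \<open>t - 1\<close>,
  each at least \<open>y ^ (t - 1)\<close>.\<close>

lemma power_diff_ge:
  fixes x y :: real
  assumes "0 \<le> y" "y \<le> x"
  shows "real t * (x - y) * y ^ (t - 1) \<le> x ^ t - y ^ t"
proof (induction t)
  case (Suc t)
  have "real (Suc t) * (x - y) * y ^ t = y * (real t * (x - y) * y ^ (t - 1)) + (x - y) * y ^ t"
    by (cases t) (auto simp: algebra_simps)
  also have "\<dots> \<le> y * (x ^ t - y ^ t) + (x - y) * y ^ t"
    using Suc assms by (intro add_mono mult_left_mono) auto
  also have "\<dots> \<le> x * (x ^ t - y ^ t) + (x - y) * y ^ t"
    using assms by (intro add_mono mult_right_mono) (auto simp: power_mono)
  also have "\<dots> = x ^ Suc t - y ^ Suc t" by (simp add: algebra_simps)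
  finally show ?case by simp
qed simp

text \<open>
  The summands telescope: with \<open>p = 1 / 2 ^ k\<close>, a summand is at most
  \<open>2 * ((1 - p / 2) ^ t - (1 - p) ^ t)\<close>.
\<close>

lemma sum_unique_hit_le:
  "(\<Sum>k=1..L. real t * (1 / 2 ^ k) * (1 - 1 / 2 ^ k) ^ (t - 1)) \<le> 2 * (1 - 1 / 2 ^ Suc L) ^ t"
proof (induction L)
  case (Suc L)
  define p :: real where "p = 1 / 2 ^ Suc L"
  have p: "0 < p" "p \<le> 1" by (auto simp: p_def divide_le_eq intro: order_trans[OF _ two_realpow_ge_one] simp del: power_Suc)
  have "real t * p * (1 - p) ^ (t - 1) = 2 * (real t * ((1 - p / 2) - (1 - p)) * (1 - p) ^ (t - 1))"
    by (simp add: algebra_simps)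
  also have "\<dots> \<le> 2 * ((1 - p / 2) ^ t - (1 - p) ^ t)"
    using p power_diff_ge[of "1 - p" "1 - p / 2" t] by simp
  finally have le: "real t * p * (1 - p) ^ (t - 1) \<le> 2 * ((1 - p / 2) ^ t - (1 - p) ^ t)" .
  have "(\<Sum>k=1..Suc L. real t * (1 / 2 ^ k) * (1 - 1 / 2 ^ k) ^ (t - 1)) =
      (\<Sum>k=1..L. real t * (1 / 2 ^ k) * (1 - 1 / 2 ^ k) ^ (t - 1)) + real t * p * (1 - p) ^ (t - 1)"
    by (simp add: p_def del: power_Suc)
  also have "\<dots> \<le> 2 * (1 - p) ^ t + 2 * ((1 - p / 2) ^ t - (1 - p) ^ t)"
    by (rule add_mono[OF _ le]) (use Suc.IH in \<open>simp only: p_def\<close>)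
  also have "\<dots> = 2 * (1 - p / 2) ^ t" by simp
  also have "p / 2 = 1 / 2 ^ Suc (Suc L)" by (simp add: p_def)
  finally show ?case .
qed simp

text \<open>By Bernoulli the denominator is at most \<open>(1 + p) ^ n\<close>, and
  \<open>(1 - p) * (1 + p) \<le> 1\<close>.\<close>

lemma one_minus_power_le:
  assumes "0 \<le> p" "p \<le> 1"
  shows "(1 - p) ^ n \<le> 1 / (1 + real n * (p::real))"
proof -
  have "(1 - p) ^ n * (1 + real n * p) \<le> (1 - p) ^ n * (1 + p) ^ n"
    using assms Bernoulli_inequality[of p n] by (intro mult_left_mono) auto
  also have "\<dots> = (1 - p\<^sup>2) ^ n"
    by (simp add: power_mult_distrib[symmetric] power2_eq_square algebra_simps)
  also have "\<dots> \<le> 1" using assms by (intro power_le_one) (auto simp: power_le_one)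
  finally show ?thesis using assms by (simp add: pos_le_divide_eq add_pos_nonneg)
qed

definition scaled_random_subset :: "'a set \<Rightarrow> nat \<Rightarrow> 'a set pmf" where
  "scaled_random_subset X L = bind_pmf (pmf_of_set {1..L}) (\<lambda>k. random_subset X (1 / 2 ^ k))"

lemma set_pmf_scaled_random_subset: "set_pmf (scaled_random_subset X L) \<subseteq> Pow X"
  using set_pmf_random_subset unfolding scaled_random_subset_def by fastforce

lemma prob_scaled_random_subset:
  assumes "1 \<le> L"
  shows "measure_pmf.prob (scaled_random_subset X L) B =
           (\<Sum>k=1..L. measure_pmf.prob (random_subset X (1 / 2 ^ k)) B) / real L"
proof -
  \<comment> \<open>Turning the event into a Boolean outcome makes \<open>pmf_bind\<close>
    applicable.\<close>
  have *: "measure_pmf.prob Q B = pmf (map_pmf (\<lambda>S. S \<in> B) Q) True" for Q :: "'a set pmf"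
    by (simp add: pmf_map vimage_def)
  show ?thesis
    unfolding * scaled_random_subset_def map_bind_pmf pmf_bind
    using assms by (subst integral_pmf_of_set) auto
qed

text \<open>The binomial masses at 1, summed over all scales, stay below 2 whatever the size of
  \<open>T\<close>; averaging divides by \<open>L\<close>.\<close>

lemma prob_unique_hit_le:
  assumes X: "finite X" and L: "1 \<le> L"
  shows "measure_pmf.prob (scaled_random_subset X L) {S. card (T \<inter> S) = 1} \<le> 2 / real L"
proof -
  define t where "t = card (T \<inter> X)"
  have "(\<Sum>k=1..L. measure_pmf.prob (random_subset X (1 / 2 ^ k)) {S. card (T \<inter> S) = 1}) =
        (\<Sum>k=1..L. real t * (1 / 2 ^ k) * (1 - 1 / 2 ^ k) ^ (t - 1))"
    using X by (intro sum.cong refl) (simp add: prob_random_subset_card t_def)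
  also have "\<dots> \<le> 2 * (1 - 1 / 2 ^ Suc L) ^ t" by (rule sum_unique_hit_le)
  also have "\<dots> \<le> 2 * 1"
    by (intro mult_left_mono power_le_one) (auto simp: divide_le_eq intro: order_trans[OF _ two_realpow_ge_one] simp del: power_Suc)
  finally show ?thesis
    using L unfolding prob_scaled_random_subset[OF L] by (intro divide_right_mono) auto
qed

text \<open>The factor 3 makes the expected size of \<open>S\<close> at least 3 at every scale, so
  \<open>S\<close> is empty with probability at most \<open>1 / (1 + 3)\<close>.\<close>

lemma prob_scaled_random_subset_empty_le:
  assumes X: "finite X" "3 * 2 ^ L \<le> card X" and L: "1 \<le> L"
  shows "measure_pmf.prob (scaled_random_subset X L) {{}} \<le> 1 / 4"
proof -
  have "measure_pmf.prob (random_subset X (1 / 2 ^ k)) {{}} \<le> 1 / 4" if k: "k \<in> {1..L}" for k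
  proof -
    have "(2::nat) ^ k \<le> 2 ^ L" using k by (intro power_increasing) auto
    then have "3 * 2 ^ k \<le> card X" using X(2) by linarith
    then have "real (3 * 2 ^ k) \<le> real (card X)" by (simp only: of_nat_le_iff)
    then have "3 \<le> real (card X) * (1 / 2 ^ k)" by (simp add: field_simps)
    moreover have "1 / (1 + y) \<le> 1 / 4" if "3 \<le> y" for y :: real
      using that by simp
    ultimately have "1 / (1 + real (card X) * (1 / 2 ^ k)) \<le> 1 / 4" by blast
    then show ?thesis
      using one_minus_power_le[of "1 / 2 ^ k" "card X"] X
      by (simp add: prob_random_subset_empty)
  qed
  then have "(\<Sum>k=1..L. measure_pmf.prob (random_subset X (1 / 2 ^ k)) {{}}) \<le> (\<Sum>k=1..L. 1 / 4)"
    by (rule sum_mono)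
  then show ?thesis using L by (simp add: prob_scaled_random_subset field_simps)
qed

text \<open>Union bound: emptiness costs \<open>1 / 4\<close>, and \<open>L div 8\<close> rounds at
  \<open>2 / L\<close> each cost another \<open>1 / 4\<close>.\<close>

lemma prob_scaled_random_subset_miss_ge:
  assumes X: "finite X" "3 * 2 ^ L \<le> card X" and L: "1 \<le> L"
  shows "1 / 2 \<le> measure_pmf.prob (scaled_random_subset X L)
           {S. S \<noteq> {} \<and> (\<forall>j<L div 8. card (T j \<inter> S) \<noteq> 1)}"
proof -
  let ?Q = "scaled_random_subset X L" and ?r = "L div 8"
  let ?G = "{S. S \<noteq> {} \<and> (\<forall>j<?r. card (T j \<inter> S) \<noteq> 1)}"
  have "1 - measure_pmf.prob ?Q ?G = measure_pmf.prob ?Q (- ?G)"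
    using measure_pmf.prob_compl[of ?G ?Q] by (simp add: Compl_eq_Diff_UNIV)
  also have "- ?G = {{}} \<union> (\<Union>j<?r. {S. card (T j \<inter> S) = 1})" by auto
  also have "measure_pmf.prob ?Q \<dots> \<le>
      measure_pmf.prob ?Q {{}} + measure_pmf.prob ?Q (\<Union>j<?r. {S. card (T j \<inter> S) = 1})"
    by (rule measure_Un_le) auto
  also have "measure_pmf.prob ?Q (\<Union>j<?r. {S. card (T j \<inter> S) = 1}) \<le>
      (\<Sum>j<?r. measure_pmf.prob ?Q {S. card (T j \<inter> S) = 1})"
    by (rule measure_pmf.finite_measure_subadditive_finite) auto
  also have "\<dots> \<le> (\<Sum>j<?r. 2 / real L)"
    by (intro sum_mono prob_unique_hit_le X L)
  also have "\<dots> \<le> 1 / 4"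
  proof -
    have "real ?r \<le> real L / 8" by linarith
    then show ?thesis using L by (simp add: field_simps)
  qed
  also have "measure_pmf.prob ?Q {{}} \<le> 1 / 4"
    by (rule prob_scaled_random_subset_empty_le[OF X L])
  finally show ?thesis by simp
qed

section \<open>Averaging and asymptotics\<close>

text \<open>Exchanges the two sources of randomness: a bound for every run against a random
  \<open>S\<close> yields one \<open>S\<close> that is bad for random runs. Finite support reduces
  the exchange to a finite sum.\<close>

lemma (in prob_space) exists_prob_ge_average:
  assumes fin: "finite (set_pmf Q)" and G: "\<And>S. S \<in> set_pmf Q \<Longrightarrow> G S \<in> events"
    and c: "\<And>\<omega>. \<omega> \<in> space M \<Longrightarrow> c \<le> measure_pmf.prob Q {S. \<omega> \<in> G S}"
  shows "\<exists>S\<in>set_pmf Q. c \<le> prob (G S)"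
proof (rule ccontr)
  assume "\<not> ?thesis"
  then have less: "prob (G S) < c" if "S \<in> set_pmf Q" for S using that by force
  have eq: "measure_pmf.prob Q {S. \<omega> \<in> G S} = (\<Sum>S\<in>set_pmf Q. pmf Q S * indicator (G S) \<omega>)" for \<omega>
  proof -
    have "measure_pmf.prob Q {S. \<omega> \<in> G S} = measure_pmf.expectation Q (indicator {S. \<omega> \<in> G S})"
      by simp
    also have "\<dots> = measure_pmf.expectation Q (\<lambda>S. indicator (G S) \<omega>)"
      by (rule Bochner_Integration.integral_cong) (auto simp: indicator_def)
    also have "\<dots> = (\<Sum>S\<in>set_pmf Q. pmf Q S * indicator (G S) \<omega>)"
      using fin by (subst integral_measure_pmf[of "set_pmf Q"]) auto
    finally show ?thesis .
  qed
  have "c = expectation (\<lambda>\<omega>. c)" by (simp add: prob_space)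
  also have "\<dots> \<le> expectation (\<lambda>\<omega>. \<Sum>S\<in>set_pmf Q. pmf Q S * indicator (G S) \<omega>)"
    using c G unfolding eq
    by (intro integral_mono Bochner_Integration.integrable_sum integrable_mult_right
        integrable_real_indicator) (auto simp: less_top[symmetric])
  also have "\<dots> = (\<Sum>S\<in>set_pmf Q. pmf Q S * prob (G S))"
    using G by (subst Bochner_Integration.integral_sum) (auto simp: less_top[symmetric])
  also have "\<dots> < (\<Sum>S\<in>set_pmf Q. pmf Q S * c)"
    using fin less by (intro sum_strict_mono set_pmf_not_empty) (auto simp: pmf_positive)
  also have "\<dots> = c" using fin by (simp add: sum_distrib_right[symmetric] sum_pmf_eq_1)
  finally show False by simp
qed

text \<open>For fixed \<open>D\<close> both functions are of order \<open>log n\<close>; the implied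
  constant may depend on \<open>D\<close>.\<close>

lemma log_bigomega:
  assumes "D \<ge> 2"
  shows "(\<lambda>n. log 2 ((real n - real D) / 3) - 1) \<in> \<Omega>(\<lambda>n. real D * log 2 (real n / real D))"
  using assms by real_asymp

section \<open>The lower bound\<close>

lemma hard_network_expected_rounds:
  fixes R :: "'r measure" and A :: "('r, 'a::countable) algorithm"
  assumes A: "randomized_algorithm R A" and D: "2 \<le> D" and L: "1 \<le> L"
    and m: "3 * 2 ^ L + 1 \<le> m" and n: "n = m + D - 1"
  obtains S where "S \<subseteq> {2..m}" "S \<noteq> {}"
    "ennreal (real L / 16) \<le> expected_rounds R A n C (hard_network m D S) 1"
proof -
  define M where "M = PiM {1..n} (\<lambda>_. R)"
  interpret R: prob_space R using A by (simp add: randomized_algorithm_def)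
  interpret M: prob_space M unfolding M_def by (intro prob_space_PiM R.prob_space_axioms)
  let ?r = "L div 8" and ?T = "\<lambda>j \<omega>. clique_transmitters A n C m \<omega> j"
  let ?Q = "scaled_random_subset {2..m} L"
  \<comment> \<open>Including \<open>S \<noteq> {}\<close> in the event lets its positive
    probability certify that the chosen \<open>S\<close> is nonempty, as connectivity
    demands.\<close>
  define G where "G S = {\<omega> \<in> space M. S \<noteq> {} \<and> (\<forall>j<?r. card (?T j \<omega> \<inter> S) \<noteq> 1)}" for S
  have mn: "m \<le> n" using D n by simp
  have G_sets: "G S \<in> sets M" for S
  proof (cases "S = {}")
    case True
    then have "G S = {}" by (simp add: G_def)
    then show ?thesis by (simp only: sets.empty_sets)
  next
    case False
    then have "G S = {\<omega> \<in> space M. \<forall>j<?r. card (?T j \<omega> \<inter> S) \<noteq> 1}" by (simp only: G_def simp_thms)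
    also have "\<dots> \<in> sets M" unfolding M_def by (rule sets_clique_transmitters_miss[OF A mn])
    finally show ?thesis .
  qed
  have "\<exists>S\<in>set_pmf ?Q. 1 / 2 \<le> M.prob (G S)"
  proof (rule M.exists_prob_ge_average)
    show "finite (set_pmf ?Q)"
      by (rule finite_subset[OF set_pmf_scaled_random_subset]) simp
    fix \<omega> assume "\<omega> \<in> space M"
    then have "{S. \<omega> \<in> G S} = {S. S \<noteq> {} \<and> (\<forall>j<?r. card (?T j \<omega> \<inter> S) \<noteq> 1)}"
      by (simp add: G_def)
    then show "1 / 2 \<le> measure_pmf.prob ?Q {S. \<omega> \<in> G S}"
      using prob_scaled_random_subset_miss_ge[of "{2..m}" L "\<lambda>j. ?T j \<omega>"] m L by simp
  qed (rule G_sets)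
  then obtain S where S: "S \<in> set_pmf ?Q" "1 / 2 \<le> M.prob (G S)" by blast
  have S_sub: "S \<subseteq> {2..m}" using S(1) set_pmf_scaled_random_subset by blast
  have S_ne: "S \<noteq> {}" using S(2) by (auto simp: G_def)
  \<comment> \<open>The extra round in \<open>Suc ?r\<close> absorbs the rounding in
    \<open>L div 8\<close>; with probability \<open>1 / 2\<close> the bound \<open>L / 8\<close>
    becomes \<open>L / 16\<close>.\<close>
  have "L \<le> 8 * Suc ?r" by presburger
  then have "real L \<le> real (8 * Suc ?r)" by (simp only: of_nat_le_iff)
  then have "real L / 16 \<le> real (Suc ?r) * (1 / 2)" by simp
  also have "\<dots> \<le> real (Suc ?r) * M.prob (G S)" using S(2) by (intro mult_left_mono) auto
  finally have "ennreal (real L / 16) \<le> ennreal (real (Suc ?r) * M.prob (G S))"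
    by (rule ennreal_leI)
  also have "\<dots> = of_nat (Suc ?r) * emeasure M (G S)"
    by (simp only: ennreal_mult'' measure_nonneg ennreal_of_nat_eq_real_of_nat M.emeasure_eq_measure)
  also have "\<dots> = (\<integral>\<^sup>+ \<omega>. of_nat (Suc ?r) * indicator (G S) \<omega> \<partial>M)"
    using G_sets by (simp add: nn_integral_cmult_indicator del: of_nat_Suc)
  \<comment> \<open>A Markov-type bound. Monotonicity of this integral holds for arbitrary
    integrands, so measurability is established for \<open>G S\<close> alone.\<close>
  also have "\<dots> \<le> (\<integral>\<^sup>+ \<omega>. broadcast_rounds A n C (hard_network m D S) 1 \<omega> \<partial>M)"
  proof (rule nn_integral_mono)
    fix \<omega>
    show "of_nat (Suc ?r) * indicator (G S) \<omega> \<le> broadcast_rounds A n C (hard_network m D S) 1 \<omega>"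
      using broadcast_rounds_ge[OF S_sub S_ne D _ n, of ?r A C \<omega>]
      by (auto simp: indicator_def G_def simp del: of_nat_Suc)
  qed
  finally have "ennreal (real L / 16) \<le> expected_rounds R A n C (hard_network m D S) 1"
    by (simp add: expected_rounds_def M_def)
  with S_sub S_ne show ?thesis by (rule that)
qed

lemma solves_global_broadcast_lower_bound:
  fixes R :: "'r measure" and A :: "('r, 'a::countable) algorithm"
  assumes f: "solves_global_broadcast R A f" and C: "1 \<le> C" and D: "2 \<le> D"
    and L: "1 \<le> L" and n: "3 * 2 ^ L + D \<le> n"
  shows "real L / 16 \<le> f n C D"
proof -
  define m where "m = n + 1 - D"
  have m: "3 * 2 ^ L + 1 \<le> m" "n = m + D - 1" using n D by (auto simp: m_def)
  have A: "randomized_algorithm R A" using f by (simp add: solves_global_broadcast_def)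
  obtain S where S: "S \<subseteq> {2..m}" "S \<noteq> {}"
    and le: "ennreal (real L / 16) \<le> expected_rounds R A n C (hard_network m D S) 1"
    by (rule hard_network_expected_rounds[OF A D L m])
  have "1 \<in> {1..n}" using m D by auto
  then have "expected_rounds R A n C (hard_network m D S) 1 \<le> ennreal (f n C D)"
    using f C connected_hard_network[OF S D] diameter_hard_network[OF S D] m(2)
    unfolding solves_global_broadcast_def by blast
  with le have "ennreal (real L / 16) \<le> ennreal (f n C D)" by (rule order_trans)
  \<comment> \<open>\<open>ennreal\<close> sends negative reals to 0; since \<open>L\<close> is
    positive, the inequality still transfers to the reals.\<close>
  then show ?thesis using L by (simp add: ennreal_le_iff2)
qed

theorem theorem9p1:
  fixes R :: "'r measure"
    and A :: "('r, 'a::countable) algorithm"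
    and f :: "nat \<Rightarrow> nat \<Rightarrow> nat \<Rightarrow> real"
  assumes "solves_global_broadcast R A f"
  shows "\<forall>C\<ge>1. \<forall>D\<ge>2. (\<lambda>n. f n C D) \<in> \<Omega>(\<lambda>n. real D * log 2 (real n / real D))"
proof (intro allI impI)
  fix C D :: nat
  assume C: "1 \<le> C" and D: "2 \<le> D"
  let ?g = "\<lambda>n. log 2 ((real n - real D) / 3) - 1"
  have "(\<lambda>n. f n C D) \<in> \<Omega>(?g)"
  proof (rule landau_omega.bigI)
    show "eventually (\<lambda>n. norm (f n C D) \<ge> 1 / 16 * norm (?g n)) sequentially"
      \<comment> \<open>From \<open>D + 6\<close> on, \<open>x \<ge> 2\<close>, so
        \<open>log 2 x \<ge> 1\<close>. This gives \<open>L \<ge> 1\<close> and makes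
        \<open>?g n\<close> nonnegative, which removes the norms.\<close>
      using eventually_ge_at_top[of "D + 6"]
    proof eventually_elim
      case (elim n)
      define x where "x = (real n - real D) / 3"
      \<comment> \<open>The largest \<open>L\<close> with \<open>3 * 2 ^ L + D \<le> n\<close>;
        rounding down accounts for the \<open>- 1\<close> in \<open>?g\<close>.\<close>
      define L where "L = nat \<lfloor>log 2 x\<rfloor>"
      have x: "2 \<le> x" using elim by (simp add: x_def)
      then have log: "1 \<le> log 2 x" by (simp add: le_log_iff)
      then have L: "1 \<le> L" "real L \<le> log 2 x" "log 2 x - 1 \<le> real L" unfolding L_def by linarith+
      have "2 ^ L \<le> x" using L(2) x by (simp add: le_log_iff powr_realpow)
      then have "real (3 * 2 ^ L + D) \<le> real n" by (simp add: x_def field_simps)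
      then have "3 * 2 ^ L + D \<le> n" by (simp only: of_nat_le_iff)
      from solves_global_broadcast_lower_bound[OF assms C D L(1) this]
      show ?case using L log by (simp add: x_def)
    qed
  qed simp
  also have "?g \<in> \<Omega>(\<lambda>n. real D * log 2 (real n / real D))"
    using D by (rule log_bigomega)
  finally show "(\<lambda>n. f n C D) \<in> \<Omega>(\<lambda>n. real D * log 2 (real n / real D))" .
qed

end
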